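(* Let $(y_k),(g_k),(t_k),(s_k),(g_k^\Psi)$ be generated by the first-order meta-algorithm described in the context, under the assumptions stated there, and let $x_k,u_k,d_k,w_k,\theta_k$ and $\mathcal{D}$ be as defined in the context. Then for every $k=1,2,\dots$ $$f(Ax_k) + \Psi(x_k) + \frac{\sum_{i=0}^{k-1} t_i\big(f^*(g_i) + \Psi^*(g_i^\Psi)\big)}{\sum_{i=0}^{k-1} t_i} + d_k^*(-w_k) = \frac{\sum_{i=0}^{k-1} \big(t_i \mathcal{D}(x_i,y_i,s_{i},\theta_i)/\theta_i -D_h(s_{i},s_{i-1})\big)}{\sum_{i=0}^{k-1} t_i}.$$ In particular, the following perturbed Fenchel duality property holds: $$f(Ax_k) + \Psi(x_k) + f^*(u_k) + (\Psi+d_k)^*(-A^*u_k) \le \delta_k$$ for $$\delta_k = \frac{\sum_{i=0}^{k-1} \big(t_i\mathcal{D}(x_i, y_i,s_{i},\theta_i)/\theta_i - D_h(s_{i},s_{i-1})\big)}{\sum_{i=0}^{k-1} t_i}.$$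
   Context: Setting. $E$ and $F$ are real vector spaces with continuous dual spaces $E^*,F^*$ and duality pairings $\langle\cdot,\cdot\rangle$; $A:E\to F$ is a linear mapping with adjoint $A^*:F^*\to E^*$; $f:F\to\mathbb{R}\cup\{\infty\}$ and $\Psi:E\to\mathbb{R}\cup\{\infty\}$ are closed convex functions with $\mathrm{dom}(\Psi)\subseteq \mathrm{dom}(\partial(f\circ A))$; $h:E\to\mathbb{R}\cup\{\infty\}$ is a convex differentiable reference function (not necessarily strictly convex) with $\mathrm{dom}(\Psi)\subseteq\overline{\mathrm{dom}(h)}$. For a function $\phi$, $\phi^*$ denotes its convex conjugate, $\phi^*(v)=\sup_x\{\langle v,x\rangle-\phi(x)\}$. The Bregman distance of $h$ is $D_h(s,z)=h(s)-h(z)-\langle\nabla h(z),s-z\rangle$ (equal to $+\infty$ when $s\notin\mathrm{dom}(h)$). First-order meta-algorithm. Input $s_{-1}\in\mathrm{dom}(\Psi)\cap\mathrm{dom}(h)$. For $k=0,1,2,\dots$: pick any $y_k\in\mathrm{dom}(\partial(f\circ A))$ and $g_k\in\partial f(Ay_k)$; pick $t_k>0$; pick $s_k\in\mathrm{argmin}_s\{t_k(\langle A^*g_k,s\rangle+\Psi(s))+D_h(s,s_{k-1})\}$. Standing assumption. At each iteration $k$ the minimizer $s_k$ exists and satisfies the optimality conditions $t_k(A^*g_k+g_k^\Psi)+\nabla h(s_k)-\nabla h(s_{k-1})=0$ for some $g_k^\Psi\in\partial\Psi(s_k)$; this $g_k^\Psi$ is fixed. Derived sequences. $x_0:=s_{-1}$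 and, for $k\ge1$, $$x_k=\frac{\sum_{i=0}^{k-1}t_is_i}{\sum_{i=0}^{k-1}t_i},\quad u_k=\frac{\sum_{i=0}^{k-1}t_ig_i}{\sum_{i=0}^{k-1}t_i},\quad w_k=\frac{\sum_{i=0}^{k-1}t_i(A^*g_i+g_i^\Psi)}{\sum_{i=0}^{k-1}t_i},\quad d_k(s)=\frac{D_h(s,s_{-1})}{\sum_{i=0}^{k-1}t_i};$$ for $k\ge0$, $\theta_k=t_k/\sum_{i=0}^kt_i$. (Thus $x_{k+1}=(1-\theta_k)x_k+\theta_ks_k$.) The function $\mathcal{D}$. For $x,s\in\mathrm{dom}(\Psi)$, $y\in\mathrm{dom}(\partial(f\circ A))$, $\theta\in[0,1]$, $$\mathcal{D}(x,y,s,\theta)=(f\circ A+\Psi)(x+\theta(s-x))-(1-\theta)(f\circ A+\Psi)(x)-\theta(f\circ A+\Psi)(s)+\theta D_{f\circ A}(s,y),$$ where $D_{f\circ A}(s,y)=f(As)-f(Ay)-\langle g,A(s-y)\rangle$ for a given $g\in\partial f(Ay)$; in $\mathcal{D}(x_i,y_i,s_i,\theta_i)$ the subgradient used is $g=g_i$. *)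

theory Defs
  imports "HOL-Analysis.Analysis"
begin

section \<open>Topological vector spaces and their continuous duals\<close>

class real_topological_vector = real_vector + topological_ab_group_add +
  assumes tendsto_scaleR_Pair:
    "LIM p (nhds (c :: real) \<times>\<^sub>F nhds x). fst p *\<^sub>R snd p :> nhds (c *\<^sub>R x)"

instance real_normed_vector \<subseteq> real_topological_vector
  by standard (intro tendsto_scaleR filterlim_fst filterlim_snd)

typedef (overloaded) 'a cdual =
  "{v :: 'a::real_topological_vector \<Rightarrow> real. linear v \<and> continuous_on UNIV v}"
  morphisms pairing Abs_cdual
proof
  show "(\<lambda>_. 0) \<in> {v :: 'a \<Rightarrow> real. linear v \<and> continuous_on UNIV v}"
    by (simp add: module_hom_zero)
qed

notation pairing (\<open>\<langle>_,/ _\<rangle>\<close>)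

setup_lifting type_definition_cdual

lemma linear_pairing: "linear (pairing v)"
  using pairing[of v] by simp

lemma continuous_on_pairing: "continuous_on UNIV (pairing v)"
  using pairing[of v] by simp

instantiation cdual :: (real_topological_vector) real_vector
begin

lift_definition zero_cdual :: "'a cdual" is "\<lambda>_. 0"
  by (simp add: module_hom_zero)

lift_definition plus_cdual :: "'a cdual \<Rightarrow> 'a cdual \<Rightarrow> 'a cdual" is "\<lambda>v w x. v x + w x"
  by (auto intro: linear_compose_add continuous_on_add)

lift_definition minus_cdual :: "'a cdual \<Rightarrow> 'a cdual \<Rightarrow> 'a cdual" is "\<lambda>v w x. v x - w x"
  by (auto intro: linear_compose_sub continuous_on_diff)

lift_definition uminus_cdual :: "'a cdual \<Rightarrow> 'a cdual" is "\<lambda>v x. - v x"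
  by (auto intro: linear_compose_neg continuous_on_minus)

lift_definition scaleR_cdual :: "real \<Rightarrow> 'a cdual \<Rightarrow> 'a cdual" is "\<lambda>c v x. c *\<^sub>R v x"
  by (auto intro: linear_compose_scale_right continuous_on_scaleR continuous_on_const
      simp flip: real_scaleR_def)

instance
  by standard (transfer; simp add: algebra_simps fun_eq_iff)+

end

definition is_adjoint ::
  "('a::real_topological_vector \<Rightarrow> 'b::real_topological_vector) \<Rightarrow> ('b cdual \<Rightarrow> 'a cdual) \<Rightarrow> bool"
  where "is_adjoint A A' \<longleftrightarrow> (\<forall>v x. \<langle>A' v, x\<rangle> = \<langle>v, A x\<rangle>)"


section \<open>Extended-valued convex functions\<close>

text \<open>
  A function with values in the reals extended by infinity is a function into the type
  \<^typ>\<open>ereal\<close> that avoids the value \<^term>\<open>-\<infinity> :: ereal\<close>.  The latter condition is not part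
  of the definitions below.
\<close>

definition edom :: "('a \<Rightarrow> ereal) \<Rightarrow> 'a set"
  where "edom \<phi> = {x. \<phi> x < \<infinity>}"

definition ext_epigraph :: "('a \<Rightarrow> ereal) \<Rightarrow> ('a \<times> real) set"
  where "ext_epigraph \<phi> = {(x, r). \<phi> x \<le> ereal r}"

definition ext_convex :: "('a::real_vector \<Rightarrow> ereal) \<Rightarrow> bool"
  where "ext_convex \<phi> \<longleftrightarrow> convex (ext_epigraph \<phi>)"

definition ext_closed :: "('a::topological_space \<Rightarrow> ereal) \<Rightarrow> bool"
  where "ext_closed \<phi> \<longleftrightarrow> closed (ext_epigraph \<phi>)"

definition subdiff :: "('a::real_topological_vector \<Rightarrow> ereal) \<Rightarrow> 'a \<Rightarrow> 'a cdual set"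
  where "subdiff \<phi> x = {v. \<bar>\<phi> x\<bar> \<noteq> \<infinity> \<and> (\<forall>z. \<phi> x + ereal \<langle>v, z - x\<rangle> \<le> \<phi> z)}"

definition dom_subdiff :: "('a::real_topological_vector \<Rightarrow> ereal) \<Rightarrow> 'a set"
  where "dom_subdiff \<phi> = {x. subdiff \<phi> x \<noteq> {}}"

definition conjugate :: "('a::real_topological_vector \<Rightarrow> ereal) \<Rightarrow> 'a cdual \<Rightarrow> ereal"
  where "conjugate \<phi> v = (SUP x. ereal \<langle>v, x\<rangle> - \<phi> x)"


section \<open>Gradients and Bregman distances\<close>

text \<open>
  The derivative is the two-sided Gateaux derivative, the weakest standard notion; on a normed
  space a Frechet gradient is in particular a gradient in this sense.  Finiteness of the limit
  forces \<^term>\<open>\<phi> (z + \<epsilon> *\<^sub>R d)\<close> to be finite for all small \<^term>\<open>\<epsilon> :: real\<close> of either sign.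
\<close>

definition has_gradient ::
  "('a::real_topological_vector \<Rightarrow> ereal) \<Rightarrow> 'a \<Rightarrow> 'a cdual \<Rightarrow> bool"
  where "has_gradient \<phi> z v \<longleftrightarrow> \<bar>\<phi> z\<bar> \<noteq> \<infinity> \<and>
    (\<forall>d. ((\<lambda>\<epsilon>::real. (\<phi> (z + \<epsilon> *\<^sub>R d) - \<phi> z) / ereal \<epsilon>) \<longlongrightarrow> ereal \<langle>v, d\<rangle>) (at 0))"

definition has_grad_at :: "('a::real_topological_vector \<Rightarrow> ereal) \<Rightarrow> 'a \<Rightarrow> bool"
  where "has_grad_at \<phi> z \<longleftrightarrow> (\<exists>v. has_gradient \<phi> z v)"

definition gradient :: "('a::real_topological_vector \<Rightarrow> ereal) \<Rightarrow> 'a \<Rightarrow> 'a cdual"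
  where "gradient \<phi> z = (THE v. has_gradient \<phi> z v)"

lemma has_gradient_unique:
  assumes "has_gradient \<phi> z v" "has_gradient \<phi> z w"
  shows "v = w"
proof -
  have "\<langle>v, d\<rangle> = \<langle>w, d\<rangle>" for d
    using tendsto_unique[of "at (0::real)"] assms unfolding has_gradient_def
    by (metis ereal.inject trivial_limit_at)
  then show ?thesis
    by (metis ext pairing_inject)
qed

lemma gradient_eq: "has_gradient \<phi> z v \<Longrightarrow> gradient \<phi> z = v"
  unfolding gradient_def using has_gradient_unique by blast

definition bregman :: "('a::real_topological_vector \<Rightarrow> ereal) \<Rightarrow> 'a \<Rightarrow> 'a \<Rightarrow> ereal"
  where "bregman h s z = h s - h z - ereal \<langle>gradient h z, s - z\<rangle>"


section \<open>Sequences derived from the iterates\<close>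

text \<open>
  The iterates \<^term>\<open>s\<close> are indexed by integers so that the starting point is \<^term>\<open>s (-1)\<close>;
  only indices from \<^term>\<open>-1 :: int\<close> on are used.  Sums over
  \<^term>\<open>i < (k::nat)\<close> in a denominator are nonzero only for \<^term>\<open>k \<ge> (1::nat)\<close>; at index 0 only
  the first sequence is meaningful.
\<close>

definition xseq :: "(nat \<Rightarrow> real) \<Rightarrow> (int \<Rightarrow> 'a::real_vector) \<Rightarrow> nat \<Rightarrow> 'a"
  where "xseq t s k =
    (if k = 0 then s (-1) else (\<Sum>i<k. t i *\<^sub>R s (int i)) /\<^sub>R (\<Sum>i<k. t i))"

definition useq ::
  "(nat \<Rightarrow> real) \<Rightarrow> (nat \<Rightarrow> 'b::real_topological_vector cdual) \<Rightarrow> nat \<Rightarrow> 'b cdual"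
  where "useq t g k = (\<Sum>i<k. t i *\<^sub>R g i) /\<^sub>R (\<Sum>i<k. t i)"

definition wseq ::
  "(nat \<Rightarrow> real) \<Rightarrow> ('b::real_topological_vector cdual \<Rightarrow> 'a::real_topological_vector cdual) \<Rightarrow>
    (nat \<Rightarrow> 'b cdual) \<Rightarrow> (nat \<Rightarrow> 'a cdual) \<Rightarrow> nat \<Rightarrow> 'a cdual"
  where "wseq t A' g g\<Psi> k = (\<Sum>i<k. t i *\<^sub>R (A' (g i) + g\<Psi> i)) /\<^sub>R (\<Sum>i<k. t i)"

definition dseq ::
  "(nat \<Rightarrow> real) \<Rightarrow> ('a::real_topological_vector \<Rightarrow> ereal) \<Rightarrow> (int \<Rightarrow> 'a) \<Rightarrow> nat \<Rightarrow> 'a \<Rightarrow> ereal"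
  where "dseq t h s k z = bregman h z (s (-1)) / ereal (\<Sum>i<k. t i)"

definition \<theta>seq :: "(nat \<Rightarrow> real) \<Rightarrow> nat \<Rightarrow> real"
  where "\<theta>seq t k = t k / (\<Sum>i\<le>k. t i)"

definition bregman_comp ::
  "('b::real_topological_vector \<Rightarrow> ereal) \<Rightarrow> ('a::real_topological_vector \<Rightarrow> 'b) \<Rightarrow> 'b cdual \<Rightarrow>
    'a \<Rightarrow> 'a \<Rightarrow> ereal"
  where "bregman_comp f A g s y = f (A s) - f (A y) - ereal \<langle>g, A (s - y)\<rangle>"

definition Dfun ::
  "('b::real_topological_vector \<Rightarrow> ereal) \<Rightarrow> ('a::real_topological_vector \<Rightarrow> 'b) \<Rightarrow>
    ('a \<Rightarrow> ereal) \<Rightarrow> 'b cdual \<Rightarrow> 'a \<Rightarrow> 'a \<Rightarrow> 'a \<Rightarrow> real \<Rightarrow> ereal"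
  where "Dfun f A \<Psi> g x y s \<theta> =
    (f (A (x + \<theta> *\<^sub>R (s - x))) + \<Psi> (x + \<theta> *\<^sub>R (s - x)))
    - ereal (1 - \<theta>) * (f (A x) + \<Psi> x)
    - ereal \<theta> * (f (A s) + \<Psi> s)
    + ereal \<theta> * bregman_comp f A g s y"

definition \<delta>seq ::
  "('b::real_topological_vector \<Rightarrow> ereal) \<Rightarrow> ('a::real_topological_vector \<Rightarrow> 'b) \<Rightarrow>
    ('a \<Rightarrow> ereal) \<Rightarrow> ('a \<Rightarrow> ereal) \<Rightarrow> (nat \<Rightarrow> real) \<Rightarrow> (nat \<Rightarrow> 'a) \<Rightarrow> (nat \<Rightarrow> 'b cdual) \<Rightarrow>
    (int \<Rightarrow> 'a) \<Rightarrow> nat \<Rightarrow> ereal"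
  where "\<delta>seq f A \<Psi> h t y g s k =
    (\<Sum>i<k. ereal (t i) * Dfun f A \<Psi> (g i) (xseq t s i) (y i) (s (int i)) (\<theta>seq t i)
              / ereal (\<theta>seq t i)
            - bregman h (s (int i)) (s (int i - 1)))
    / ereal (\<Sum>i<k. t i)"

end

theory Submission
  imports Defs
begin

text \<open>
  Both claims reduce to real arithmetic once the conjugates are evaluated.  Write \<open>T\<^sub>k\<close> for the sum of
  the first \<open>k\<close> step sizes, \<open>\<phi> = f \<circ> A + \<Psi>\<close>, and \<open>v\<^sub>j\<close> for the gradient of \<open>h\<close> at \<open>s\<^sub>j\<close>.

  A conjugate evaluated at a subgradient is attained at the point of subdifferentiability
  (\<open>conjugate_eq_of_subdiff\<close>).  This gives \<open>f\<^sup>*(g\<^sub>i)\<close> and \<open>\<Psi>\<^sup>*(g\<^sub>i\<^sup>\<Psi>)\<close> at once.  It also gives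
  \<open>d\<^sub>k\<^sup>*(-w\<^sub>k)\<close>: the optimality conditions telescope to \<open>-T\<^sub>k w\<^sub>k = v\<^sub>k\<^sub>-\<^sub>1 - v\<^sub>-\<^sub>1\<close>, the gradient at
  \<open>s\<^sub>k\<^sub>-\<^sub>1\<close> of the Bregman distance from \<open>s\<^sub>-\<^sub>1\<close>, and a gradient of a convex function is a subgradient,
  so the supremum is attained at \<open>s\<^sub>k\<^sub>-\<^sub>1\<close>.

  Two telescoping sums then remain.  Since \<open>t\<^sub>i / \<theta>\<^sub>i = T\<^sub>i\<^sub>+\<^sub>1\<close> and
  \<open>x\<^sub>i\<^sub>+\<^sub>1 = x\<^sub>i + \<theta>\<^sub>i (s\<^sub>i - x\<^sub>i)\<close>, the scaled term \<open>t\<^sub>i \<D>\<^sub>i / \<theta>\<^sub>i\<close> is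
  \<open>T\<^sub>i\<^sub>+\<^sub>1 \<phi>(x\<^sub>i\<^sub>+\<^sub>1) - T\<^sub>i \<phi>(x\<^sub>i)\<close> plus terms that only involve \<open>s\<^sub>i\<close>, \<open>y\<^sub>i\<close> and \<open>g\<^sub>i\<close>
  (\<open>scaled_Dfun\<close>).  The Bregman distances telescope by the three-point identity
  (\<open>bregman_telescope\<close>).  Comparing the two sides gives the equality.

  The inequality follows from it by convexity of \<open>f\<^sup>*\<close> and \<open>\<Psi>\<^sup>*\<close> (\<open>conjugate_average_le\<close>) together
  with \<open>(\<Psi> + d\<^sub>k)\<^sup>*(p + q) \<le> \<Psi>\<^sup>*(p) + d\<^sub>k\<^sup>*(q)\<close> (\<open>conjugate_add_le\<close>), where \<open>p\<close> is the weighted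
  average of the \<open>g\<^sub>i\<^sup>\<Psi>\<close> and \<open>q = -w\<^sub>k\<close>, so that \<open>p + q = -A\<^sup>* u\<^sub>k\<close>.
\<close>

section \<open>Pairings\<close>

lemmas pairing_simps =
  zero_cdual.rep_eq plus_cdual.rep_eq minus_cdual.rep_eq uminus_cdual.rep_eq scaleR_cdual.rep_eq
  linear_0[OF linear_pairing] linear_add[OF linear_pairing] linear_diff[OF linear_pairing] linear_scale[OF linear_pairing]

lemma pairing_sum: "\<langle>sum v I, x\<rangle> = (\<Sum>i\<in>I. \<langle>v i, x\<rangle>)"
  by (induction I rule: infinite_finite_induct) (simp_all add: pairing_simps)

lemma pairing_eqI: "(\<And>x. \<langle>v, x\<rangle> = \<langle>w, x\<rangle>) \<Longrightarrow> v = w"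
  by (metis ext pairing_inject)

lemma adjoint_sum_scaleR:
  assumes "is_adjoint A A'"
  shows "A' ((\<Sum>i\<in>I. t i *\<^sub>R g i) /\<^sub>R T) = (\<Sum>i\<in>I. t i *\<^sub>R A' (g i)) /\<^sub>R T"
  using assms by (intro pairing_eqI) (simp add: is_adjoint_def pairing_simps pairing_sum)

section \<open>Convexity and subgradients\<close>

lemma ext_convex_line:
  assumes "ext_convex \<phi>" "\<phi> x = ereal a" "\<phi> z = ereal b" "0 \<le> u" "u \<le> 1"
  shows "\<phi> (x + u *\<^sub>R (z - x)) \<le> ereal ((1 - u) * a + u * b)"
proof -
  have "(1 - u) *\<^sub>R (x, a) + u *\<^sub>R (z, b) \<in> ext_epigraph \<phi>"
    using assms by (intro convexD) (auto simp: ext_convex_def ext_epigraph_def)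
  moreover have "(1 - u) *\<^sub>R x + u *\<^sub>R z = x + u *\<^sub>R (z - x)"
    by (simp add: algebra_simps)
  ultimately show ?thesis
    by (simp add: ext_epigraph_def)
qed

lemma edom_line:
  assumes "ext_convex \<phi>" "\<forall>z. \<phi> z \<noteq> -\<infinity>" "x \<in> edom \<phi>" "z \<in> edom \<phi>" "0 \<le> u" "u \<le> 1"
  shows "x + u *\<^sub>R (z - x) \<in> edom \<phi>"
proof -
  obtain a b where "\<phi> x = ereal a" "\<phi> z = ereal b"
    using assms unfolding edom_def by (cases "\<phi> x"; cases "\<phi> z") auto
  from ext_convex_line[OF assms(1) this assms(5,6)] show ?thesis
    by (auto simp: edom_def intro: le_less_trans)
qed

text \<open>
  Along the segment towards \<^term>\<open>x\<close>, convexity bounds every difference quotient by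
  \<open>\<phi> x - \<phi> z\<close>, hence also its limit.
\<close>

lemma has_gradient_in_subdiff:
  assumes "ext_convex \<phi>" "\<forall>x. \<phi> x \<noteq> -\<infinity>" "has_gradient \<phi> z v"
  shows "v \<in> subdiff \<phi> z"
proof -
  from assms(3) obtain a where a: "\<phi> z = ereal a"
    unfolding has_gradient_def by (cases "\<phi> z") auto
  have "\<phi> z + ereal \<langle>v, x - z\<rangle> \<le> \<phi> x" for x
  proof (cases "\<phi> x")
    case (real b)
    let ?q = "\<lambda>\<epsilon>::real. (\<phi> (z + \<epsilon> *\<^sub>R (x - z)) - \<phi> z) / ereal \<epsilon>"
    have lim: "(?q \<longlongrightarrow> ereal \<langle>v, x - z\<rangle>) (at_right 0)"
      using assms(3) unfolding has_gradient_def
      by (auto intro: tendsto_mono[OF at_le])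
    have "?q \<epsilon> \<le> ereal (b - a)" if "0 < \<epsilon>" "\<epsilon> < 1" for \<epsilon>
    proof -
      have le: "\<phi> (z + \<epsilon> *\<^sub>R (x - z)) \<le> ereal ((1 - \<epsilon>) * a + \<epsilon> * b)"
        using that by (intro ext_convex_line[OF assms(1) a real]) auto
      then obtain c where c: "\<phi> (z + \<epsilon> *\<^sub>R (x - z)) = ereal c"
        using assms(2) by (cases "\<phi> (z + \<epsilon> *\<^sub>R (x - z))") auto
      then have "(c - a) / \<epsilon> \<le> b - a"
        using le that by (simp add: field_simps)
      then show ?thesis
        using that by (simp add: c a)
    qed
    then have "eventually (\<lambda>\<epsilon>. ?q \<epsilon> \<le> ereal (b - a)) (at_right 0)"
      unfolding eventually_at_right_field by (intro exI[of _ 1]) auto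
    from tendsto_upperbound[OF lim this] show ?thesis
      by (simp add: a real)
  qed (use assms(2) in auto)
  then show ?thesis
    by (simp add: subdiff_def a)
qed

lemma dom_subdiff_finite:
  assumes "x \<in> dom_subdiff \<phi>"
  shows "\<phi> x = ereal (real_of_ereal (\<phi> x))"
  using assms by (auto simp: dom_subdiff_def subdiff_def ereal_real)

text \<open>
  The Bregman distance from \<open>z\<^sub>0\<close> is \<open>h\<close> plus an affine function of slope \<open>-\<nabla>h(z\<^sub>0)\<close>, so each
  subgradient is shifted by that slope and then scaled by \<open>1/T\<close>.
\<close>

lemma subdiff_bregman:
  assumes v: "v \<in> subdiff h x" and h0: "h z0 = ereal a" and T: "T > 0"
  shows "(v - gradient h z0) /\<^sub>R T \<in> subdiff (\<lambda>z. bregman h z z0 / ereal T) x"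
proof -
  from v obtain b where b: "h x = ereal b"
    unfolding subdiff_def by (cases "h x") auto
  have "bregman h x z0 / ereal T + ereal \<langle>(v - gradient h z0) /\<^sub>R T, z - x\<rangle>
      \<le> bregman h z z0 / ereal T" for z
  proof (cases "h z")
    case (real c)
    have "b + \<langle>v, z - x\<rangle> \<le> c"
      using v by (simp add: subdiff_def b) (metis ereal_less_eq(3) plus_ereal.simps(1) real)
    then have "(b - a - \<langle>gradient h z0, x - z0\<rangle> + \<langle>v - gradient h z0, z - x\<rangle>) / T
        \<le> (c - a - \<langle>gradient h z0, z - z0\<rangle>) / T"
      using T by (intro divide_right_mono) (auto simp: pairing_simps)
    also have "(b - a - \<langle>gradient h z0, x - z0\<rangle> + \<langle>v - gradient h z0, z - x\<rangle>) / T
        = (b - a - \<langle>gradient h z0, x - z0\<rangle>) / T + \<langle>(v - gradient h z0) /\<^sub>R T, z - x\<rangle>"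
      by (simp add: scaleR_cdual.rep_eq divide_inverse_commute distrib_left)
    finally show ?thesis
      using T by (simp add: bregman_def h0 b real)
  next
    case MInf
    have "h x + ereal \<langle>v, z - x\<rangle> \<le> h z"
      using v by (simp add: subdiff_def)
    then show ?thesis
      by (simp add: b MInf)
  qed (use T in \<open>simp add: bregman_def h0\<close>)
  then show ?thesis
    using T by (simp add: subdiff_def bregman_def h0 b)
qed

section \<open>Conjugates\<close>

lemma conjugate_eq_of_subdiff:
  assumes v: "v \<in> subdiff \<phi> x" and x: "\<phi> x = ereal a"
  shows "conjugate \<phi> v = ereal (\<langle>v, x\<rangle> - a)"
  unfolding conjugate_def
proof (rule SUP_eqI)
  fix z
  have "ereal a + ereal \<langle>v, z - x\<rangle> \<le> \<phi> z"
    using v by (simp add: subdiff_def x)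
  then show "ereal \<langle>v, z\<rangle> - \<phi> z \<le> ereal (\<langle>v, x\<rangle> - a)"
    by (cases "\<phi> z") (auto simp: pairing_simps)
next
  fix c assume "\<And>z. z \<in> UNIV \<Longrightarrow> ereal \<langle>v, z\<rangle> - \<phi> z \<le> c"
  from this[of x] show "ereal (\<langle>v, x\<rangle> - a) \<le> c"
    by (simp add: x)
qed

lemma Fenchel_Young:
  assumes "conjugate \<phi> v \<le> ereal c" "\<phi> z = ereal r"
  shows "\<langle>v, z\<rangle> - r \<le> c"
proof -
  have "ereal \<langle>v, z\<rangle> - \<phi> z \<le> conjugate \<phi> v"
    unfolding conjugate_def by (rule SUP_upper) simp
  also note assms(1)
  finally show ?thesis
    by (simp add: assms(2))
qed

text \<open>A conjugate is a supremum of affine functions of the dual variable, hence convex.\<close>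

lemma conjugate_average_le:
  assumes \<phi>: "\<forall>z. \<phi> z \<noteq> -\<infinity>"
    and t: "\<And>i. i \<in> I \<Longrightarrow> 0 \<le> t i" "sum t I > 0"
    and c: "\<And>i. i \<in> I \<Longrightarrow> conjugate \<phi> (v i) \<le> ereal (c i)"
  shows "conjugate \<phi> ((\<Sum>i\<in>I. t i *\<^sub>R v i) /\<^sub>R sum t I) \<le> ereal ((\<Sum>i\<in>I. t i * c i) / sum t I)"
  unfolding conjugate_def
proof (rule SUP_least)
  fix z
  show "ereal \<langle>(\<Sum>i\<in>I. t i *\<^sub>R v i) /\<^sub>R sum t I, z\<rangle> - \<phi> z \<le> ereal ((\<Sum>i\<in>I. t i * c i) / sum t I)"
  proof (cases "\<phi> z")
    case (real r)
    have "(\<Sum>i\<in>I. t i * (\<langle>v i, z\<rangle> - r)) \<le> (\<Sum>i\<in>I. t i * c i)"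
      using t(1) Fenchel_Young[OF c real] by (intro sum_mono mult_left_mono) auto
    moreover have "(\<Sum>i\<in>I. t i * (\<langle>v i, z\<rangle> - r)) = (\<Sum>i\<in>I. t i * \<langle>v i, z\<rangle>) - sum t I * r"
      by (simp add: right_diff_distrib sum_subtractf sum_distrib_right)
    ultimately have "((\<Sum>i\<in>I. t i * \<langle>v i, z\<rangle>) - sum t I * r) / sum t I \<le> (\<Sum>i\<in>I. t i * c i) / sum t I"
      using t(2) by (intro divide_right_mono) auto
    also have "((\<Sum>i\<in>I. t i * \<langle>v i, z\<rangle>) - sum t I * r) / sum t I
        = \<langle>(\<Sum>i\<in>I. t i *\<^sub>R v i) /\<^sub>R sum t I, z\<rangle> - r"
      using t(2) by (simp add: pairing_simps pairing_sum field_simps)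
    finally show ?thesis
      by (simp add: real)
  qed (use \<phi> in auto)
qed

lemma conjugate_add_le:
  assumes "\<forall>z. \<phi> z \<noteq> -\<infinity>" "\<forall>z. \<psi> z \<noteq> -\<infinity>"
    and "conjugate \<phi> v \<le> ereal a" "conjugate \<psi> w \<le> ereal b"
  shows "conjugate (\<lambda>z. \<phi> z + \<psi> z) (v + w) \<le> ereal (a + b)"
  unfolding conjugate_def
proof (rule SUP_least)
  fix z
  show "ereal \<langle>v + w, z\<rangle> - (\<phi> z + \<psi> z) \<le> ereal (a + b)"
  proof (cases "\<phi> z"; cases "\<psi> z")
    fix p q assume "\<phi> z = ereal p" "\<psi> z = ereal q"
    with Fenchel_Young[OF assms(3) this(1)] Fenchel_Young[OF assms(4) this(2)] show ?thesis
      by (simp add: pairing_simps)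
  qed (use assms(1,2) in auto)
qed

section \<open>Averages and telescoping sums\<close>

text \<open>At \<open>i = 0\<close> the recursion discards the starting point, as \<open>\<theta>\<^sub>0 = 1\<close>.\<close>

lemma xseq_Suc:
  assumes "\<forall>i. t i > 0"
  shows "xseq t s (Suc i) = xseq t s i + \<theta>seq t i *\<^sub>R (s (int i) - xseq t s i)"
proof (cases i)
  case 0
  have "t 0 \<noteq> 0"
    using assms by (metis less_irrefl)
  then show ?thesis
    by (simp add: 0 xseq_def \<theta>seq_def)
next
  case (Suc j)
  let ?T = "\<Sum>i<i. t i" and ?S = "\<Sum>i<i. t i *\<^sub>R s (int i)"
  have T: "?T > 0"
    using assms by (intro sum_pos) (auto simp: Suc)
  then have T': "?T + t i > 0"
    using assms by (simp add: add_pos_pos)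
  have S: "?S = ?T *\<^sub>R xseq t s i"
    using T by (simp add: xseq_def Suc)
  have "(?T + t i) *\<^sub>R xseq t s (Suc i) = ?S + t i *\<^sub>R s (int i)"
    using T' by (simp add: xseq_def)
  also have "\<dots> = (?T + t i) *\<^sub>R (xseq t s i + \<theta>seq t i *\<^sub>R (s (int i) - xseq t s i))"
    using T' unfolding S
    by (simp add: \<theta>seq_def lessThan_Suc_atMost[symmetric] scaleR_add_right) (simp add: algebra_simps)
  finally show ?thesis
    using T' by (metis less_irrefl scaleR_cancel_left)
qed

lemma \<theta>seq_bounds:
  assumes "\<forall>i. t i > 0"
  shows "0 < \<theta>seq t i" "\<theta>seq t i \<le> 1" "t i / \<theta>seq t i = (\<Sum>j<Suc i. t j)"
proof -
  have ge: "0 \<le> (\<Sum>j<i. t j)" and ti: "t i > 0"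
    using assms by (auto intro: sum_nonneg less_imp_le)
  then show "0 < \<theta>seq t i" "\<theta>seq t i \<le> 1" "t i / \<theta>seq t i = (\<Sum>j<Suc i. t j)"
    by (auto simp: \<theta>seq_def lessThan_Suc_atMost[symmetric] field_simps)
qed

lemma xseq_in_edom:
  assumes "\<forall>i. t i > 0" "ext_convex \<phi>" "\<forall>z. \<phi> z \<noteq> -\<infinity>"
    and "s (-1) \<in> edom \<phi>" "\<And>i. s (int i) \<in> edom \<phi>"
  shows "xseq t s i \<in> edom \<phi>"
proof (induction i)
  case 0
  then show ?case
    using assms(4) by (simp add: xseq_def)
next
  case (Suc i)
  then show ?case
    using assms \<theta>seq_bounds[OF assms(1), of i] by (simp add: xseq_Suc edom_line)
qed

text \<open>
  Multiplying \<open>\<D>\<close> by \<open>t\<^sub>i / \<theta>\<^sub>i = T\<^sub>i\<^sub>+\<^sub>1\<close> turns the weights \<open>1\<close>, \<open>1 - \<theta>\<^sub>i\<close>, \<open>\<theta>\<^sub>i\<close> into \<open>T\<^sub>i\<^sub>+\<^sub>1\<close>, \<open>T\<^sub>i\<close>,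
  \<open>t\<^sub>i\<close>, so the values along the averages \<open>x\<^sub>i\<close> telescope.  The value \<open>f(As\<^sub>i)\<close> cancels against the
  one in the Bregman distance of \<open>f \<circ> A\<close>.
\<close>

lemma scaled_Dfun:
  assumes t: "\<forall>i. t i > 0" and A: "linear A"
    and x: "f (A (xseq t s i)) = ereal fx" "\<Psi> (xseq t s i) = ereal \<psi>x"
    and x': "f (A (xseq t s (Suc i))) = ereal fx'" "\<Psi> (xseq t s (Suc i)) = ereal \<psi>x'"
    and s: "f (A (s (int i))) = ereal fs" "\<Psi> (s (int i)) = ereal \<psi>s"
    and y: "f (A y) = ereal fy"
  shows "ereal (t i) * Dfun f A \<Psi> g (xseq t s i) y (s (int i)) (\<theta>seq t i) / ereal (\<theta>seq t i)
    = ereal ((\<Sum>j<Suc i. t j) * (fx' + \<psi>x') - (\<Sum>j<i. t j) * (fx + \<psi>x)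
        + t i * (\<langle>g, A y\<rangle> - fy - \<psi>s - \<langle>g, A (s (int i))\<rangle>))"
proof -
  let ?\<theta> = "\<theta>seq t i" and ?T = "\<Sum>j<i. t j"
  define D where "D = (fx' + \<psi>x') - (1 - ?\<theta>) * (fx + \<psi>x) - ?\<theta> * (fs + \<psi>s)
    + ?\<theta> * (fs - fy - \<langle>g, A (s (int i) - y)\<rangle>)"
  note \<theta> = \<theta>seq_bounds[OF t, of i]
  have "Dfun f A \<Psi> g (xseq t s i) y (s (int i)) ?\<theta> = ereal D"
    using x x' s y by (simp add: Dfun_def bregman_comp_def D_def flip: xseq_Suc[OF t])
  moreover have "t i * D / ?\<theta> = (?T + t i) * (fx' + \<psi>x') - ?T * (fx + \<psi>x)
      + t i * (\<langle>g, A y\<rangle> - fy - \<psi>s - \<langle>g, A (s (int i))\<rangle>)"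
  proof -
    have "t i * D / ?\<theta> = (?T + t i) * D"
      using \<theta>(3) by (simp flip: times_divide_eq_left)
    moreover have "(?T + t i) * ?\<theta> = t i"
      using \<theta> by (simp add: field_simps)
    ultimately show ?thesis
      unfolding D_def by (simp add: linear_diff[OF A] pairing_simps) algebra
  qed
  ultimately show ?thesis
    using \<theta>(1) by simp
qed

text \<open>
  Each step of the induction is the three-point identity for the Bregman distances between
  \<open>s\<^sub>-\<^sub>1\<close>, \<open>s\<^sub>n\<^sub>-\<^sub>1\<close> and \<open>s\<^sub>n\<close>; here \<open>H\<close> and \<open>v\<close> stand for the values and gradients of the
  reference function at the iterates.
\<close>

lemma bregman_telescope:
  fixes s :: "int \<Rightarrow> 'a::real_topological_vector" and v :: "int \<Rightarrow> 'a cdual" and H :: "int \<Rightarrow> real"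
  defines "B \<equiv> \<lambda>i j. H i - H j - \<langle>v j, s i - s j\<rangle>"
  shows "(\<Sum>i<n. B (int i) (int i - 1)) =
    (\<Sum>i<n. \<langle>v (int i) - v (int i - 1), s (int i)\<rangle>)
    - \<langle>v (int n - 1) - v (-1), s (int n - 1)\<rangle> + B (int n - 1) (-1)"
  unfolding B_def by (induction n) (simp_all add: pairing_simps)

lemma sum_telescope_int:
  fixes v :: "int \<Rightarrow> 'a::ab_group_add"
  shows "(\<Sum>i<n. v (int i - 1) - v (int i)) = v (-1) - v (int n - 1)"
  by (induction n) simp_all

section \<open>The duality identity\<close>

theorem theorem2:
  fixes A :: "'e::real_topological_vector \<Rightarrow> 'f::real_topological_vector"
    and A' :: "'f cdual \<Rightarrow> 'e cdual"
    and f :: "'f \<Rightarrow> ereal"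
    and \<Psi> h :: "'e \<Rightarrow> ereal"
    and y :: "nat \<Rightarrow> 'e"
    and g :: "nat \<Rightarrow> 'f cdual"
    and t :: "nat \<Rightarrow> real"
    and s :: "int \<Rightarrow> 'e"
    and g\<Psi> :: "nat \<Rightarrow> 'e cdual"
    and k :: nat
  assumes A: "linear A" "is_adjoint A A'"
    and f: "\<forall>z. f z \<noteq> -\<infinity>" "ext_convex f" "ext_closed f"
    and \<Psi>: "\<forall>z. \<Psi> z \<noteq> -\<infinity>" "ext_convex \<Psi>" "ext_closed \<Psi>"
    and dom_\<Psi>: "edom \<Psi> \<subseteq> dom_subdiff (f \<circ> A)"
    and h: "\<forall>z. h z \<noteq> -\<infinity>" "ext_convex h" "\<forall>z \<in> interior (edom h). has_grad_at h z"
    and dom_h: "edom \<Psi> \<subseteq> closure (edom h)"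
    and init: "s (-1) \<in> edom \<Psi> \<inter> edom h"
    and y: "\<forall>i. y i \<in> dom_subdiff (f \<circ> A)"
    and g: "\<forall>i. g i \<in> subdiff f (A (y i))"
    and t: "\<forall>i. t i > 0"
    and argmin: "\<forall>i. is_arg_min
      (\<lambda>z. ereal (t i) * (ereal \<langle>A' (g i), z\<rangle> + \<Psi> z) + bregman h z (s (int i - 1)))
      (\<lambda>_. True) (s (int i))"
    and grad_s: "\<forall>j \<ge> -1. has_grad_at h (s j)"
    and g\<Psi>: "\<forall>i. g\<Psi> i \<in> subdiff \<Psi> (s (int i))"
    and optimality: "\<forall>i. t i *\<^sub>R (A' (g i) + g\<Psi> i)
      + gradient h (s (int i)) - gradient h (s (int i - 1)) = 0"
    and k: "k \<ge> 1"
  shows "(f (A (xseq t s k)) + \<Psi> (xseq t s k)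
      + (\<Sum>i<k. ereal (t i) * (conjugate f (g i) + conjugate \<Psi> (g\<Psi> i))) / ereal (\<Sum>i<k. t i)
      + conjugate (dseq t h s k) (- wseq t A' g g\<Psi> k)
      = \<delta>seq f A \<Psi> h t y g s k)
    \<and> (f (A (xseq t s k)) + \<Psi> (xseq t s k) + conjugate f (useq t g k)
      + conjugate (\<lambda>z. \<Psi> z + dseq t h s k z) (- A' (useq t g k))
      \<le> \<delta>seq f A \<Psi> h t y g s k)"
proof -
  define T where "T n = (\<Sum>i<n. t i)" for n
  define x where "x = xseq t s"
  define F where "F z = real_of_ereal (f (A z))" for z
  define P where "P z = real_of_ereal (\<Psi> z)" for z
  define H where "H j = real_of_ereal (h (s j))" for j
  define v where "v j = gradient h (s j)" for j
  define B where "B i j = H i - H j - \<langle>v j, s i - s j\<rangle>" for i j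
  have Tk: "T k > 0"
    using t k unfolding T_def by (intro sum_pos) (auto simp: lessThan_empty_iff)

  \<comment> \<open>All values of \<open>f\<close>, \<open>\<Psi>\<close> and \<open>h\<close> in the identity are finite, which is what allows the passage to reals.\<close>
  have s_dom: "s (int i) \<in> edom \<Psi>" for i
    using g\<Psi>[rule_format, of i] by (cases "\<Psi> (s (int i))") (auto simp: subdiff_def edom_def)
  then have x_dom: "x i \<in> edom \<Psi>" for i
    unfolding x_def using init by (intro xseq_in_edom[OF t \<Psi>(2,1)]) auto
  have P: "\<Psi> z = ereal (P z)" if "z \<in> edom \<Psi>" for z
    using that \<Psi>(1) unfolding P_def edom_def by (cases "\<Psi> z") auto
  have F: "f (A z) = ereal (F z)" if "z \<in> dom_subdiff (f \<circ> A)" for z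
    using dom_subdiff_finite[OF that] by (simp add: F_def)
  have F': "f (A z) = ereal (F z)" if "z \<in> edom \<Psi>" for z
    using that dom_\<Psi> by (intro F) auto
  have Fy: "f (A (y i)) = ereal (F (y i))" for i
    using y by (intro F) auto
  have grad: "has_gradient h (s j) (v j)" if "j \<ge> -1" for j
    using grad_s that gradient_eq unfolding v_def has_grad_at_def by metis
  have H: "h (s j) = ereal (H j)" if "j \<ge> -1" for j
    using grad[OF that] unfolding H_def has_gradient_def by (auto simp: ereal_real)
  have breg: "bregman h (s i) (s j) = ereal (B i j)" if "i \<ge> -1" "j \<ge> -1" for i j
    using that by (simp add: bregman_def H B_def v_def)

  have opt: "t i *\<^sub>R (A' (g i) + g\<Psi> i) = v (int i - 1) - v (int i)" for i
    using optimality[rule_format, of i] by (simp add: v_def algebra_simps eq_diff_eq)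
  have "(\<Sum>i<k. t i *\<^sub>R (A' (g i) + g\<Psi> i)) = v (-1) - v (int k - 1)"
    by (simp only: opt sum_telescope_int)
  then have w: "- wseq t A' g g\<Psi> k = (v (int k - 1) - v (-1)) /\<^sub>R T k"
    by (simp add: wseq_def T_def flip: scaleR_minus_right)

  have conj_f: "conjugate f (g i) = ereal (\<langle>g i, A (y i)\<rangle> - F (y i))" for i
    using g Fy by (intro conjugate_eq_of_subdiff) auto
  have conj_\<Psi>: "conjugate \<Psi> (g\<Psi> i) = ereal (\<langle>g\<Psi> i, s (int i)\<rangle> - P (s (int i)))" for i
    using g\<Psi> P[OF s_dom] by (intro conjugate_eq_of_subdiff) auto
  have "v (int k - 1) \<in> subdiff h (s (int k - 1))"
    using k by (intro has_gradient_in_subdiff[OF h(2,1)] grad) auto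
  from subdiff_bregman[of _ h _ "s (-1)", OF this H Tk]
  have w_sub: "- wseq t A' g g\<Psi> k \<in> subdiff (dseq t h s k) (s (int k - 1))"
    unfolding w by (simp add: dseq_def[abs_def] T_def v_def)
  define C where "C = \<langle>v (int k - 1) - v (-1), s (int k - 1)\<rangle> - B (int k - 1) (-1)"
  have conj_d: "conjugate (dseq t h s k) (- wseq t A' g g\<Psi> k) = ereal (C / T k)"
  proof -
    have "dseq t h s k (s (int k - 1)) = ereal (B (int k - 1) (-1) / T k)"
      using k Tk by (simp add: dseq_def breg T_def)
    from conjugate_eq_of_subdiff[OF w_sub this] show ?thesis
      using Tk by (simp add: w C_def pairing_simps field_simps)
  qed

  define a where "a i = \<langle>g i, A (y i)\<rangle> - F (y i)" for i
  define b where "b i = \<langle>g\<Psi> i, s (int i)\<rangle> - P (s (int i))" for i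
  define r where "r i = T (Suc i) * (F (x (Suc i)) + P (x (Suc i))) - T i * (F (x i) + P (x i))
    + t i * (a i - P (s (int i)) - \<langle>g i, A (s (int i))\<rangle>)" for i
  have D: "ereal (t i) * Dfun f A \<Psi> (g i) (x i) (y i) (s (int i)) (\<theta>seq t i) / ereal (\<theta>seq t i)
      = ereal (r i)" for i
    unfolding r_def a_def T_def x_def
    by (intro scaled_Dfun t A) (simp_all add: P F' Fy s_dom x_dom flip: x_def)
  have \<delta>: "\<delta>seq f A \<Psi> h t y g s k = ereal ((\<Sum>i<k. r i - B (int i) (int i - 1)) / T k)"
    using Tk by (simp add: \<delta>seq_def breg D flip: x_def T_def)

  have sum_r: "(\<Sum>i<k. r i) = T k * (F (x k) + P (x k))
      + (\<Sum>i<k. t i * (a i - P (s (int i)) - \<langle>g i, A (s (int i))\<rangle>))"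
    unfolding r_def sum.distrib
    unfolding sum_lessThan_telescope[of "\<lambda>i. T i * (F (x i) + P (x i))"] by (simp add: T_def)
  \<comment> \<open>The optimality condition, paired with \<open>s\<^sub>i\<close>, trades \<open>A\<^sup>*g\<^sub>i\<close> for \<open>g\<^sub>i\<^sup>\<Psi>\<close> and a difference of gradients.\<close>
  have step: "t i * (a i - P (s (int i)) - \<langle>g i, A (s (int i))\<rangle>)
      = t i * (a i + b i) + \<langle>v (int i) - v (int i - 1), s (int i)\<rangle>" for i
  proof -
    have "t i * (\<langle>g i, A (s (int i))\<rangle> + \<langle>g\<Psi> i, s (int i)\<rangle>)
        = \<langle>v (int i - 1) - v (int i), s (int i)\<rangle>"
      using A(2) by (simp add: pairing_simps is_adjoint_def flip: opt)
    then show ?thesis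
      by (simp add: b_def pairing_simps algebra_simps)
  qed
  have key: "(\<Sum>i<k. r i - B (int i) (int i - 1))
      = T k * (F (x k) + P (x k)) + (\<Sum>i<k. t i * (a i + b i)) + C"
    using bregman_telescope[of H v s k]
    unfolding sum_subtractf sum_r step sum.distrib C_def B_def by simp

  have eq: "F (x k) + P (x k) + (\<Sum>i<k. t i * (a i + b i)) / T k + C / T k
      = (\<Sum>i<k. r i - B (int i) (int i - 1)) / T k"
    using Tk unfolding key by (simp add: field_simps)
  have first: "f (A (x k)) + \<Psi> (x k)
      + (\<Sum>i<k. ereal (t i) * (conjugate f (g i) + conjugate \<Psi> (g\<Psi> i))) / ereal (T k)
      + conjugate (dseq t h s k) (- wseq t A' g g\<Psi> k) = \<delta>seq f A \<Psi> h t y g s k"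
    using Tk eq by (simp add: conj_f conj_\<Psi> conj_d \<delta> P F' x_dom flip: a_def b_def)

  have f_avg: "conjugate f (useq t g k) \<le> ereal ((\<Sum>i<k. t i * a i) / T k)"
    using t Tk unfolding useq_def T_def
    by (intro conjugate_average_le[OF f(1)]) (auto simp: conj_f a_def less_imp_le)
  let ?p = "(\<Sum>i<k. t i *\<^sub>R g\<Psi> i) /\<^sub>R T k"
  have \<Psi>_avg: "conjugate \<Psi> ?p \<le> ereal ((\<Sum>i<k. t i * b i) / T k)"
    using t Tk unfolding T_def
    by (intro conjugate_average_le[OF \<Psi>(1)]) (auto simp: conj_\<Psi> b_def less_imp_le)
  have split: "- A' (useq t g k) = ?p + - wseq t A' g g\<Psi> k"
    unfolding useq_def wseq_def adjoint_sum_scaleR[OF A(2)] T_def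
    by (simp add: scaleR_add_right sum.distrib)
  have d_fin: "\<forall>z. dseq t h s k z \<noteq> -\<infinity>"
  proof
    fix z
    show "dseq t h s k z \<noteq> -\<infinity>"
      using h(1)[rule_format, of z] Tk
      by (cases "h z") (auto simp: dseq_def bregman_def H simp flip: T_def)
  qed
  have sum_avg: "conjugate (\<lambda>z. \<Psi> z + dseq t h s k z) (- A' (useq t g k))
      \<le> ereal ((\<Sum>i<k. t i * b i) / T k + C / T k)"
    unfolding split by (intro conjugate_add_le \<Psi>(1) d_fin \<Psi>_avg) (simp add: conj_d)
  have "f (A (x k)) + \<Psi> (x k) + conjugate f (useq t g k)
      + conjugate (\<lambda>z. \<Psi> z + dseq t h s k z) (- A' (useq t g k))
      \<le> ereal (F (x k) + P (x k)) + ereal ((\<Sum>i<k. t i * a i) / T k)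
        + ereal ((\<Sum>i<k. t i * b i) / T k + C / T k)"
    using f_avg sum_avg by (intro add_mono) (simp_all add: P F' x_dom)
  also have "\<dots> = \<delta>seq f A \<Psi> h t y g s k"
    using eq by (simp add: \<delta> distrib_left sum.distrib add_divide_distrib)
  finally show ?thesis
    using first by (simp add: x_def T_def)
qed

end
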